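(* Let $q\ge1$ and let $\{M_1(t)\}_{t\ge0},\dots,\{M_q(t)\}_{t\ge0}$ be independent generalized counting processes, where $M_i$ has positive rates $\lambda_{i1},\dots,\lambda_{ik_i}$, and let $\{M_0(t)\}_{t\ge0}$ be a generalized counting process with positive rates $\mu_1,\dots,\mu_{k_0}$, independent of $(M_1,\dots,M_q)$. Let $\bar{\mathcal M}(t)=(M_1(M_0(t)),\dots,M_q(M_0(t)))$ and $\Lambda=\sum_{i=1}^{q}\sum_{j_i=1}^{k_i}\lambda_{ij_i}$. The probability mass function $\hat p_{\bar{\mathcal M}}(\bar n,t)=\mathrm{Pr}\{\bar{\mathcal M}(t)=\bar n\}$, $\bar n\ge\bar0$, solves $$\frac{\mathrm{d}}{\mathrm{d}t}\hat p_{\bar{\mathcal M}}(\bar n,t)=-\sum_{j_0=1}^{k_0}\mu_{j_0}(1-e^{-j_0\Lambda})\hat p_{\bar{\mathcal M}}(\bar n,t)+\sum_{\bar m\succ\bar0}\hat p_{\bar{\mathcal M}}(\bar n-\bar m,t)\sum_{j_0=1}^{k_0}\mu_{j_0}e^{-j_0\Lambda}\sum_{\substack{\Omega(k_i,m_i)\\ i=1,2,\dots,q}}\prod_{i=1}^{q}\prod_{j_i=1}^{k_i}\frac{(j_0\lambda_{ij_i})^{x_{ij_i}}}{x_{ij_i}!}$$ with initial condition $\hat p_{\bar{\mathcal M}}(\bar n,0)=1$ if $\bar n=\bar0$ and $0$ otherwise.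
   Context: A generalized counting process (GCP) $\{M(t)\}_{t\ge0}$ with positive rates $\lambda_1,\dots,\lambda_k$ is a right-continuous $\mathbb{N}_0$-valued process with $M(0)=0$ and stationary independent increments, whose probability generating function is $\mathbb{E}(u^{M(t)})=\exp\big(-t\sum_{j=1}^{k}\lambda_j(1-u^j)\big)$, $|u|\le1$. The process $\bar{\mathcal M}$ is called the multivariate IGCP. Vectors $\bar n=(n_1,\dots,n_q)$, $\bar m=(m_1,\dots,m_q)$ have integer entries, $\bar0=(0,\dots,0)$; $\bar n\ge\bar m$ means $n_i\ge m_i$ for all $i$, and $\bar m\succ\bar0$ means $\bar m\ge\bar0$ and $\bar m\ne\bar0$. $\Omega(k_i,m_i)=\{(x_{i1},\dots,x_{ik_i})\in\mathbb{N}_0^{k_i}:\sum_{j_i=1}^{k_i}j_ix_{ij_i}=m_i\}$, and the sum is over all choices of one element from each $\Omega(k_i,m_i)$, $i=1,\dots,q$. Set $\hat p_{\bar{\mathcal M}}(\bar n-\bar m,t)=0$ if $\bar n-\bar m$ has a negative entry. *)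

theory Defs
  imports "HOL-Probability.Probability"
begin

text \<open>Processes are indexed by \<open>real\<close>, but only the times \<open>t \<ge> 0\<close> are constrained. Increments are
  taken in \<open>int\<close>, since subtraction on \<open>nat\<close> truncates.\<close>

definition independent_increments :: "'a measure \<Rightarrow> (real \<Rightarrow> 'a \<Rightarrow> nat) \<Rightarrow> bool" where
  "independent_increments P M \<longleftrightarrow>
     (\<forall>(N::nat) (t::nat \<Rightarrow> real). 0 \<le> t 0 \<and> (\<forall>l<N. t l < t (Suc l)) \<longrightarrow>
        prob_space.indep_vars P (\<lambda>_. count_space UNIV)
          (\<lambda>l \<omega>. int (M (t (Suc l)) \<omega>) - int (M (t l) \<omega>)) {..<N})"

definition stationary_increments :: "'a measure \<Rightarrow> (real \<Rightarrow> 'a \<Rightarrow> nat) \<Rightarrow> bool" where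
  "stationary_increments P M \<longleftrightarrow>
     (\<forall>s\<ge>0. \<forall>t\<ge>0.
        distr P (count_space UNIV) (\<lambda>\<omega>. int (M (s + t) \<omega>) - int (M s \<omega>)) =
        distr P (count_space UNIV) (\<lambda>\<omega>. int (M t \<omega>) - int (M 0 \<omega>)))"

definition generalized_counting_process ::
    "'a measure \<Rightarrow> nat \<Rightarrow> (nat \<Rightarrow> real) \<Rightarrow> (real \<Rightarrow> 'a \<Rightarrow> nat) \<Rightarrow> bool" where
  "generalized_counting_process P k rate M \<longleftrightarrow>
     1 \<le> k \<and> (\<forall>j\<in>{1..k}. 0 < rate j) \<and>
     (\<forall>t\<ge>0. M t \<in> measurable P (count_space UNIV)) \<and>
     (\<forall>\<omega>\<in>space P. M 0 \<omega> = 0) \<and>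
     (\<forall>\<omega>\<in>space P. \<forall>t\<ge>0. continuous (at_right t) (\<lambda>s. M s \<omega>)) \<and>
     stationary_increments P M \<and>
     independent_increments P M \<and>
     (\<forall>t\<ge>0. \<forall>u::real. \<bar>u\<bar> \<le> 1 \<longrightarrow>
        integral\<^sup>L P (\<lambda>\<omega>. u ^ M t \<omega>) = exp (- t * (\<Sum>j=1..k. rate j * (1 - u ^ j))))"

text \<open>Independence of processes is independence of their sample paths, viewed as random elements
  of the product space of \<open>nat\<close> over \<open>{0..}\<close>.\<close>

definition path_space :: "(real \<Rightarrow> nat) measure" where
  "path_space = PiM {0..} (\<lambda>_. count_space UNIV)"

definition path :: "(real \<Rightarrow> 'a \<Rightarrow> nat) \<Rightarrow> 'a \<Rightarrow> real \<Rightarrow> nat" where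
  "path M \<omega> = (\<lambda>t\<in>{0..}. M t \<omega>)"

definition independent_processes :: "'a measure \<Rightarrow> ('q \<Rightarrow> real \<Rightarrow> 'a \<Rightarrow> nat) \<Rightarrow> bool" where
  "independent_processes P M \<longleftrightarrow>
     prob_space.indep_vars P (\<lambda>_. path_space) (\<lambda>i. path (M i)) UNIV"

text \<open>The library's \<open>indep_var\<close> needs both variables to have the same type, so independence of
  \<open>M0\<close> from the family \<open>M\<close> is expressed by the generated sigma-algebras.\<close>

definition independent_of_family ::
    "'a measure \<Rightarrow> (real \<Rightarrow> 'a \<Rightarrow> nat) \<Rightarrow> ('q \<Rightarrow> real \<Rightarrow> 'a \<Rightarrow> nat) \<Rightarrow> bool" where
  "independent_of_family P M0 M \<longleftrightarrow>
     prob_space.indep_set P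
       (sets (vimage_algebra (space P) (path M0) path_space))
       (sets (vimage_algebra (space P) (\<lambda>\<omega> i. path (M i) \<omega>) (PiM UNIV (\<lambda>_. path_space))))"

text \<open>The \<open>q\<close> coordinates are indexed by a finite type \<open>'q\<close>, which is nonempty, so \<open>q \<ge> 1\<close>.\<close>

definition igcp ::
    "('q::finite \<Rightarrow> real \<Rightarrow> 'a \<Rightarrow> nat) \<Rightarrow> (real \<Rightarrow> 'a \<Rightarrow> nat) \<Rightarrow> real \<Rightarrow> 'a \<Rightarrow> int ^ 'q" where
  "igcp M M0 t \<omega> = (\<chi> i. int (M i (real (M0 t \<omega>)) \<omega>))"

text \<open>Since the process has nonnegative entries, this vanishes as soon as \<open>n\<close> has a negative entry,
  which is the convention used for \<open>n - m\<close> in the equation.\<close>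

definition igcp_pmf ::
    "'a measure \<Rightarrow> ('q::finite \<Rightarrow> real \<Rightarrow> 'a \<Rightarrow> nat) \<Rightarrow> (real \<Rightarrow> 'a \<Rightarrow> nat) \<Rightarrow> int ^ 'q \<Rightarrow> real \<Rightarrow> real" where
  "igcp_pmf P M M0 n t = measure P {\<omega> \<in> space P. igcp M M0 t \<omega> = n}"

definition Omega :: "nat \<Rightarrow> int \<Rightarrow> (nat \<Rightarrow> nat) set" where
  "Omega k m = {x \<in> {1..k} \<rightarrow>\<^sub>E UNIV. int (\<Sum>j=1..k. j * x j) = m}"

end

theory Submission
  imports Defs
begin

text \<open>
  Conditioning on \<open>M0 t = s\<close> gives \<open>p(n,t) = (\<Sum>s. a(t,s) * g(n,s))\<close>, where \<open>a(t,s)\<close> is the mass function of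
  \<open>M0\<close> and \<open>g(n,s)\<close> is the product of the mass functions of the \<open>M i\<close> at time \<open>s\<close>. Comparing
  coefficients in the generating functions shows that \<open>exp (- j * Lam)\<close> times the sum over \<open>Omega\<close> is
  \<open>g(m,j)\<close>, and that \<open>g(n,s+j) = (\<Sum>m. g(m,j) * g(n-m,s))\<close>. Lowering one exponent in the sum over
  \<open>Omega\<close> gives the forward equation \<open>a'(t,s) = (\<Sum>j. mu j * (a(t,s-j) - a(t,s)))\<close>. Differentiating the series termwise and
  shifting the index by \<open>j\<close> gives \<open>p'(n,t) = (\<Sum>j. mu j * ((\<Sum>m. g(m,j) * p(n-m,t)) - p(n,t)))\<close>; the term
  \<open>m = 0\<close> of the inner sum contributes \<open>exp (- j * Lam) * p(n,t)\<close>.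
\<close>

section \<open>Power series and the generating function of the sum over \<open>Omega\<close>\<close>

text \<open>Induction on the index for the difference of the two series: once all coefficients below
  \<open>m\<close> vanish, dividing by \<open>x ^ m\<close> leaves a series that is zero for small
  \<open>x\<close> other than 0, and its limit at 0 is the coefficient at \<open>m\<close>.\<close>

lemma powser_coeff_unique:
  fixes a b :: "nat \<Rightarrow> real"
  assumes r: "0 < r"
    and a: "\<And>x. \<bar>x\<bar> < r \<Longrightarrow> (\<lambda>n. a n * x ^ n) sums f x"
    and b: "\<And>x. \<bar>x\<bar> < r \<Longrightarrow> (\<lambda>n. b n * x ^ n) sums f x"
  shows "a = b"
proof
  define c where "c n = a n - b n" for n
  have c: "(\<lambda>n. c n * x ^ n) sums 0" if "\<bar>x\<bar> < r" for x
    using sums_diff[OF a[OF that] b[OF that]] by (simp add: c_def algebra_simps)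
  fix m
  have "c m = 0"
  proof (induction m rule: less_induct)
    case (less m)
    have "(\<lambda>n. c (n + m) * x ^ n) sums 0" if "x \<noteq> 0" "norm x < r" for x
    proof -
      have "(\<lambda>n. c (n + m) * x ^ (n + m)) sums 0"
        using sums_iff_shift[of "\<lambda>n. c n * x ^ n" m 0] c[of x] that less by simp
      then have "(\<lambda>n. (c (n + m) * x ^ (n + m)) / x ^ m) sums (0 / x ^ m)"
        by (rule sums_divide)
      with that show ?thesis by (simp add: power_add)
    qed
    from LIM_const_eq[OF powser_limit_0_strong[OF r this]] show ?case by simp
  qed
  then show "a m = b m" by (simp add: c_def)
qed

text \<open>The sum over \<open>Omega k m\<close> is the coefficient of \<open>u ^ m\<close> in
  \<open>exp (t * (\<Sum>j=1..k. r j * u ^ j))\<close>.\<close>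

definition gcp_coeff :: "nat \<Rightarrow> (nat \<Rightarrow> real) \<Rightarrow> real \<Rightarrow> nat \<Rightarrow> real" where
  "gcp_coeff k r t m = (\<Sum>x\<in>Omega k (int m). \<Prod>j=1..k. (t * r j) ^ x j / fact (x j))"

lemma Omega_of_nat: "Omega k (int m) = {x \<in> {1..k} \<rightarrow>\<^sub>E UNIV. (\<Sum>j=1..k. j * x j) = m}"
  unfolding Omega_def of_nat_eq_iff ..

lemma finite_Omega [simp]: "finite (Omega k m)"
proof (rule finite_subset)
  show "Omega k m \<subseteq> {1..k} \<rightarrow>\<^sub>E {..nat m}"
  proof
    fix x assume x: "x \<in> Omega k m"
    have "x j \<le> nat m" if j: "j \<in> {1..k}" for j
    proof -
      have "x j \<le> j * x j" using j by simp
      also have "\<dots> \<le> (\<Sum>j=1..k. j * x j)"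
        using member_le_sum[OF j, of "\<lambda>j. j * x j"] by simp
      also have "\<dots> = nat m" using x by (auto simp: Omega_def simp del: of_nat_sum)
      finally show ?thesis .
    qed
    with x show "x \<in> {1..k} \<rightarrow>\<^sub>E {..nat m}" by (auto simp: Omega_def PiE_iff)
  qed
qed (simp add: finite_PiE)

text \<open>The exponential is a product of \<open>k\<close> absolutely convergent exponential
  series. Multiplying out gives one term for each choice \<open>x\<close> of exponents, and grouping
  these by the weight \<open>\<Sum>j=1..k. j * x j\<close> collects the coefficient of each power of
  \<open>u\<close>.\<close>

lemma gcp_coeff_sums: "(\<lambda>m. gcp_coeff k r t m * u ^ m) sums exp (t * (\<Sum>j=1..k. r j * u ^ j))"
proof -
  define f where "f j n = (t * r j * u ^ j) ^ n / fact n" for j n :: nat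
  define S where "S = exp (t * (\<Sum>j=1..k. r j * u ^ j))"
  have norm: "summable (\<lambda>n. norm (f j n))" for j
    using summable_norm_exp[of "t * r j * u ^ j"] by (simp add: f_def divide_inverse mult.commute)
  then have abs: "(\<lambda>n. norm (f j n)) summable_on UNIV" for j
    by (intro norm_summable_imp_summable_on) simp
  have exp: "infsum (f j) UNIV = exp (t * r j * u ^ j)" for j
  proof (rule infsumI, rule norm_summable_imp_has_sum)
    show "summable (\<lambda>n. norm (f j n))" by (rule norm)
    show "f j sums exp (t * r j * u ^ j)"
      using exp_converges[of "t * r j * u ^ j"] by (simp add: f_def[abs_def] divide_inverse mult.commute)
  qed
  have inf: "infsum (\<lambda>x. \<Prod>j=1..k. f j (x j)) ({1..k} \<rightarrow>\<^sub>E UNIV) = S"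
    by (subst infsum_prod_PiE_abs) (use abs in \<open>auto simp: exp S_def exp_sum sum_distrib_left mult.assoc\<close>)
  have "((\<lambda>x. \<Prod>j=1..k. f j (x j)) has_sum S) ({1..k} \<rightarrow>\<^sub>E UNIV)"
  proof -
    \<comment> \<open>\<open>infsum\<close> is 0 on families that are not summable, whereas
      \<open>S\<close> is an exponential and hence nonzero, so the value alone proves
      summability.\<close>
    have "(\<lambda>x. \<Prod>j=1..k. f j (x j)) summable_on ({1..k} \<rightarrow>\<^sub>E UNIV)"
      using infsum_not_exists inf by (fastforce simp: S_def)
    with inf show ?thesis by (metis has_sum_infsum)
  qed
  \<comment> \<open>Each choice of exponents has exactly one weight, so the sets
    \<open>Omega k (int m)\<close> partition the index set.\<close>
  then have "((\<lambda>p. \<Prod>j=1..k. f j (snd p j)) has_sum S) (SIGMA m:UNIV. Omega k (int m))"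
    by (rule has_sum_reindex_bij_witness[of _ snd "\<lambda>x. (\<Sum>j=1..k. j * x j, x)", THEN iffD1, rotated -1])
      (auto simp: Omega_of_nat)
  then have "((\<lambda>m. \<Sum>x\<in>Omega k (int m). \<Prod>j=1..k. f j (x j)) has_sum S) UNIV"
    by (rule has_sum_SigmaD) simp
  moreover have "(\<Sum>x\<in>Omega k (int m). \<Prod>j=1..k. f j (x j)) = gcp_coeff k r t m * u ^ m" for m
    unfolding gcp_coeff_def sum_distrib_right
  proof (rule sum.cong)
    fix x assume "x \<in> Omega k (int m)"
    then have m: "(\<Sum>j=1..k. j * x j) = m" by (simp add: Omega_of_nat)
    have "(\<Prod>j=1..k. f j (x j)) = (\<Prod>j=1..k. (t * r j) ^ x j / fact (x j) * u ^ (j * x j))"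
      by (simp add: f_def power_mult_distrib power_mult)
    also have "\<dots> = (\<Prod>j=1..k. (t * r j) ^ x j / fact (x j)) * u ^ m"
      by (simp only: prod.distrib power_sum[symmetric] m)
    finally show "(\<Prod>j=1..k. f j (x j)) = (\<Prod>j=1..k. (t * r j) ^ x j / fact (x j)) * u ^ m" .
  qed simp
  ultimately show ?thesis
    by (simp add: S_def has_sum_imp_sums)
qed

lemma gcp_coeff_nonneg: "\<lbrakk>0 \<le> t; \<And>j. j \<in> {1..k} \<Longrightarrow> 0 \<le> r j\<rbrakk> \<Longrightarrow> 0 \<le> gcp_coeff k r t m"
  unfolding gcp_coeff_def by (intro sum_nonneg prod_nonneg) auto

text \<open>Monotonicity in time lets the value at the right end of an interval serve as a majorant
  when a series of coefficients is differentiated termwise.\<close>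

lemma gcp_coeff_mono:
  "\<lbrakk>0 \<le> s; s \<le> t; \<And>j. j \<in> {1..k} \<Longrightarrow> 0 \<le> r j\<rbrakk> \<Longrightarrow> gcp_coeff k r s m \<le> gcp_coeff k r t m"
  unfolding gcp_coeff_def
  by (intro sum_mono prod_mono conjI divide_right_mono power_mono mult_right_mono) auto

lemma summable_gcp_coeff: "summable (gcp_coeff k r t)"
  using sums_summable[OF gcp_coeff_sums[of k r t 1]] by simp

lemma gcp_coeff_0: "gcp_coeff k r 0 m = (if m = 0 then 1 else 0)"
proof -
  have "gcp_coeff k r 0 = (\<lambda>m. if m = 0 then 1 else 0)"
  proof (rule powser_coeff_unique[of 1])
    show "(\<lambda>n. gcp_coeff k r 0 n * x ^ n) sums 1" for x
      using gcp_coeff_sums[of k r 0 x] by simp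
    show "(\<lambda>n. (if n = 0 then 1 else 0) * x ^ n) sums 1" for x :: real
      using sums_If_finite_set[of "{0}" "\<lambda>_. 1::real"]
      by (simp add: if_distrib[of "\<lambda>y. y * _"] cong: if_cong)
  qed simp
  then show ?thesis by simp
qed

text \<open>The generating functions at times \<open>s\<close> and \<open>t\<close> multiply to the
  one at \<open>s + t\<close>; the Cauchy product and uniqueness of coefficients do the
  rest.\<close>

lemma gcp_coeff_add:
  assumes "\<And>j. j \<in> {1..k} \<Longrightarrow> 0 \<le> r j" "0 \<le> s" "0 \<le> t"
  shows "gcp_coeff k r (s + t) n = (\<Sum>i\<le>n. gcp_coeff k r s i * gcp_coeff k r t (n - i))"
proof -
  have "(\<lambda>n. \<Sum>i\<le>n. gcp_coeff k r s i * gcp_coeff k r t (n - i)) = gcp_coeff k r (s + t)"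
  proof (rule powser_coeff_unique[of 1])
    fix u :: real
    show "(\<lambda>n. gcp_coeff k r (s + t) n * u ^ n) sums exp ((s + t) * (\<Sum>j=1..k. r j * u ^ j))"
      by (rule gcp_coeff_sums)
    \<comment> \<open>The coefficients are nonnegative, so the series of norms is the same power
      series at \<open>\<bar>u\<bar>\<close>.\<close>
    have abs: "summable (\<lambda>m. norm (gcp_coeff k r t m * u ^ m))" if "0 \<le> t" for t
      using gcp_coeff_sums[of k r t "\<bar>u\<bar>", THEN sums_summable] gcp_coeff_nonneg[of t k r] that assms(1)
      by (simp add: abs_mult power_abs)
    have "(\<lambda>n. \<Sum>i\<le>n. gcp_coeff k r s i * u ^ i * (gcp_coeff k r t (n - i) * u ^ (n - i)))
        sums (exp (s * (\<Sum>j=1..k. r j * u ^ j)) * exp (t * (\<Sum>j=1..k. r j * u ^ j)))"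
      using Cauchy_product_sums[OF abs[OF assms(2)] abs[OF assms(3)]]
      by (simp add: sums_unique[OF gcp_coeff_sums, symmetric])
    moreover have "(\<Sum>i\<le>n. gcp_coeff k r s i * u ^ i * (gcp_coeff k r t (n - i) * u ^ (n - i)))
        = (\<Sum>i\<le>n. gcp_coeff k r s i * gcp_coeff k r t (n - i)) * u ^ n" for n
      unfolding sum_distrib_right
    proof (rule sum.cong)
      fix i assume "i \<in> {..n}"
      then have "u ^ n = u ^ i * u ^ (n - i)" by (simp flip: power_add)
      then show "gcp_coeff k r s i * u ^ i * (gcp_coeff k r t (n - i) * u ^ (n - i))
        = gcp_coeff k r s i * gcp_coeff k r t (n - i) * u ^ n" by simp
    qed simp
    ultimately show "(\<lambda>n. (\<Sum>i\<le>n. gcp_coeff k r s i * gcp_coeff k r t (n - i)) * u ^ n)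
        sums exp ((s + t) * (\<Sum>j=1..k. r j * u ^ j))"
      by (simp add: distrib_right exp_add)
  qed simp
  then show ?thesis by metis
qed

text \<open>The product rule is applied to each term of the finite sum over \<open>Omega\<close>.
  Differentiating factor \<open>j\<close> produces \<open>r j\<close> and lowers the exponent
  \<open>x j\<close> by one, which lowers the weight by \<open>j\<close>.\<close>

lemma gcp_coeff_has_derivative:
  "((\<lambda>t. gcp_coeff k r t m) has_real_derivative
      (\<Sum>j=1..k. r j * (if j \<le> m then gcp_coeff k r t (m - j) else 0))) (at t)"
proof -
  define T where "T x = (\<Prod>j=1..k. (t * r j) ^ x j / fact (x j))" for x :: "nat \<Rightarrow> nat"
  \<comment> \<open>The case \<open>n = 0\<close> is separate because truncated subtraction would
    turn the derivative of a constant into \<open>r j\<close>.\<close>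
  have D: "((\<lambda>t. (t * r j) ^ n / fact n) has_real_derivative
      r j * (if n = 0 then 0 else (t * r j) ^ (n - 1) / fact (n - 1))) (at t)" for j n
  proof (cases n)
    case (Suc l)
    have "((\<lambda>t. (t * r j) ^ Suc l / fact (Suc l)) has_real_derivative
        real (Suc l) * (t * r j) ^ l * r j / fact (Suc l)) (at t)"
      by (auto intro!: derivative_eq_intros simp del: of_nat_Suc power_Suc fact_Suc)
    also have "real (Suc l) * (t * r j) ^ l * r j / fact (Suc l) = r j * ((t * r j) ^ l / fact l)"
      unfolding fact_Suc of_nat_mult by (simp del: of_nat_Suc)
    finally show ?thesis using Suc by (simp del: of_nat_Suc power_Suc fact_Suc)
  qed simp
  \<comment> \<open>Lowering \<open>x j\<close> is a bijection from the elements of weight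
    \<open>m\<close> with \<open>x j > 0\<close> onto those of weight \<open>m - j\<close>. If
    \<open>j > m\<close>, no element of weight \<open>m\<close> has \<open>x j > 0\<close>.\<close>
  have shift: "(\<Sum>x\<in>Omega k (int m). if x j = 0 then 0 else T (x(j := x j - 1)))
      = (if j \<le> m then gcp_coeff k r t (m - j) else 0)" if j: "j \<in> {1..k}" for j
  proof -
    have upd: "(\<Sum>i=1..k. i * (x(j := c)) i) = j * c + (\<Sum>i\<in>{1..k} - {j}. i * x i)"
      for x :: "nat \<Rightarrow> nat" and c
      using j by (subst sum.remove[of _ j]) (auto intro!: sum.cong)
    have upd': "(\<Sum>i=1..k. i * x i) = j * x j + (\<Sum>i\<in>{1..k} - {j}. i * x i)" for x :: "nat \<Rightarrow> nat"
      using j by (subst sum.remove[of _ j]) auto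
    have "(\<Sum>x\<in>Omega k (int m). if x j = 0 then 0 else T (x(j := x j - 1)))
        = (\<Sum>x\<in>{x \<in> Omega k (int m). 0 < x j}. T (x(j := x j - 1)))"
      by (intro sum.mono_neutral_cong_right) auto
    also have "\<dots> = (if j \<le> m then gcp_coeff k r t (m - j) else 0)"
    proof (cases "j \<le> m")
      case True
      have down: "x(j := x j - 1) \<in> Omega k (int (m - j))"
        if "x \<in> Omega k (int m)" "0 < x j" for x
      proof -
        from that have "j * x j + (\<Sum>i\<in>{1..k} - {j}. i * x i) = m"
          by (simp only: Omega_of_nat mem_Collect_eq upd')
        moreover have "j * x j = j * (x j - 1) + j"
          using \<open>0 < x j\<close> by (cases "x j") auto
        ultimately have "j * (x j - 1) + (\<Sum>i\<in>{1..k} - {j}. i * x i) = m - j" by linarith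
        with that j show ?thesis
          unfolding Omega_of_nat mem_Collect_eq upd by (auto simp: PiE_iff extensional_def)
      qed
      have up: "x(j := Suc (x j)) \<in> Omega k (int m)" if "x \<in> Omega k (int (m - j))" for x
      proof -
        from that have "j * x j + (\<Sum>i\<in>{1..k} - {j}. i * x i) = m - j"
          by (simp only: Omega_of_nat mem_Collect_eq upd')
        with True have "j * Suc (x j) + (\<Sum>i\<in>{1..k} - {j}. i * x i) = m" by simp
        with that j show ?thesis
          unfolding Omega_of_nat mem_Collect_eq upd by (auto simp: PiE_iff extensional_def)
      qed
      have "(\<Sum>x\<in>{x \<in> Omega k (int m). 0 < x j}. T (x(j := x j - 1))) = sum T (Omega k (int (m - j)))"
        by (rule sum.reindex_bij_witness[of _ "\<lambda>x. x(j := Suc (x j))" "\<lambda>x. x(j := x j - 1)"])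
          (use down up in auto)
      with True show ?thesis by (simp add: gcp_coeff_def T_def)
    next
      case False
      have "{x \<in> Omega k (int m). 0 < x j} = {}"
      proof -
        have "j \<le> m" if "0 < x j" "x \<in> Omega k (int m)" for x
        proof -
          have "j \<le> j * x j" using that by simp
          also have "\<dots> \<le> m" using that upd'[of x] by (simp add: Omega_of_nat)
          finally show ?thesis .
        qed
        with False show ?thesis by blast
      qed
      with False show ?thesis by (simp del: Collect_empty_eq)
    qed
    finally show ?thesis .
  qed
  have "((\<lambda>t. gcp_coeff k r t m) has_real_derivative
      (\<Sum>x\<in>Omega k (int m). \<Sum>j=1..k. r j * (if x j = 0 then 0 else (t * r j) ^ (x j - 1) / fact (x j - 1)) *
         (\<Prod>i\<in>{1..k} - {j}. (t * r i) ^ x i / fact (x i)))) (at t)"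
    unfolding gcp_coeff_def by (intro DERIV_sum has_field_derivative_prod D)
  also have "(\<Sum>x\<in>Omega k (int m). \<Sum>j=1..k. r j * (if x j = 0 then 0 else (t * r j) ^ (x j - 1) / fact (x j - 1)) *
         (\<Prod>i\<in>{1..k} - {j}. (t * r i) ^ x i / fact (x i)))
     = (\<Sum>x\<in>Omega k (int m). \<Sum>j=1..k. r j * (if x j = 0 then 0 else T (x(j := x j - 1))))"
  proof (intro sum.cong refl)
    fix x j assume "j \<in> {1..k}"
    then have "T (x(j := x j - 1)) = (t * r j) ^ (x j - 1) / fact (x j - 1) *
         (\<Prod>i\<in>{1..k} - {j}. (t * r i) ^ x i / fact (x i))"
      unfolding T_def by (subst prod.remove[of _ j]) (auto intro!: prod.cong)
    then show "r j * (if x j = 0 then 0 else (t * r j) ^ (x j - 1) / fact (x j - 1)) *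
         (\<Prod>i\<in>{1..k} - {j}. (t * r i) ^ x i / fact (x i))
       = r j * (if x j = 0 then 0 else T (x(j := x j - 1)))" by simp
  qed
  also have "\<dots> = (\<Sum>j=1..k. r j * (\<Sum>x\<in>Omega k (int m). if x j = 0 then 0 else T (x(j := x j - 1))))"
    by (subst sum.swap) (simp add: sum_distrib_left)
  also have "\<dots> = (\<Sum>j=1..k. r j * (if j \<le> m then gcp_coeff k r t (m - j) else 0))"
    by (intro sum.cong refl) (simp only: shift)
  finally show ?thesis .
qed

section \<open>The mass function of a generalized counting process in closed form\<close>

text \<open>The exponential prefactor is kept apart from \<open>gcp_coeff\<close> because only the
  latter is monotone in \<open>t\<close>, which termwise differentiation relies on.\<close>

definition gcp_prob :: "nat \<Rightarrow> (nat \<Rightarrow> real) \<Rightarrow> real \<Rightarrow> nat \<Rightarrow> real" where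
  "gcp_prob k r t m = exp (- t * (\<Sum>j=1..k. r j)) * gcp_coeff k r t m"

lemma gcp_prob_sums:
  "(\<lambda>m. gcp_prob k r t m * u ^ m) sums exp (- t * (\<Sum>j=1..k. r j * (1 - u ^ j)))"
proof -
  have "(\<lambda>m. exp (- t * (\<Sum>j=1..k. r j)) * (gcp_coeff k r t m * u ^ m)) sums
      (exp (- t * (\<Sum>j=1..k. r j)) * exp (t * (\<Sum>j=1..k. r j * u ^ j)))"
    by (intro sums_mult gcp_coeff_sums)
  also have "exp (- t * (\<Sum>j=1..k. r j)) * exp (t * (\<Sum>j=1..k. r j * u ^ j))
      = exp (- t * (\<Sum>j=1..k. r j * (1 - u ^ j)))"
    by (simp add: exp_add[symmetric] algebra_simps sum_subtractf)
  finally show ?thesis by (simp add: gcp_prob_def mult.assoc)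
qed

lemma summable_gcp_prob: "summable (gcp_prob k r t)"
  using sums_summable[OF gcp_prob_sums[of k r t 1]] by simp

lemma gcp_prob_nonneg: "\<lbrakk>0 \<le> t; \<And>j. j \<in> {1..k} \<Longrightarrow> 0 \<le> r j\<rbrakk> \<Longrightarrow> 0 \<le> gcp_prob k r t m"
  unfolding gcp_prob_def by (intro mult_nonneg_nonneg gcp_coeff_nonneg) auto

lemma gcp_prob_0: "gcp_prob k r 0 m = (if m = 0 then 1 else 0)"
  by (simp add: gcp_prob_def gcp_coeff_0)

lemma gcp_prob_zero: "gcp_prob k r t 0 = exp (- t * (\<Sum>j=1..k. r j))"
proof -
  have "gcp_prob k r t 0 = exp (- t * (\<Sum>j=1..k. r j * (1 - 0 ^ j)))"
    using sums_unique[OF gcp_prob_sums[of k r t 0]] by (simp only: powser_zero)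
  \<comment> \<open>The index starts at 1, so every \<open>0 ^ j\<close> vanishes.\<close>
  also have "(\<Sum>j=1..k. r j * (1 - 0 ^ j)) = (\<Sum>j=1..k. r j)"
    by (intro sum.cong) auto
  finally show ?thesis .
qed

lemma gcp_prob_add:
  assumes "\<And>j. j \<in> {1..k} \<Longrightarrow> 0 \<le> r j" "0 \<le> s" "0 \<le> t"
  shows "gcp_prob k r (s + t) n = (\<Sum>i\<le>n. gcp_prob k r s i * gcp_prob k r t (n - i))"
proof -
  define R where "R = (\<Sum>j=1..k. r j)"
  have "exp (- (s + t) * R) = exp (- s * R) * exp (- t * R)"
    by (simp add: algebra_simps flip: exp_add)
  moreover have "gcp_coeff k r (s + t) n = (\<Sum>i\<le>n. gcp_coeff k r s i * gcp_coeff k r t (n - i))"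
    by (intro gcp_coeff_add assms)
  ultimately show ?thesis
    unfolding gcp_prob_def R_def[symmetric]
    by (simp add: sum_distrib_left mult_ac)
qed

text \<open>A single nonnegative term is at most the total mass, which is the generating function at
  1.\<close>

lemma gcp_prob_le_1:
  assumes "\<And>j. j \<in> {1..k} \<Longrightarrow> 0 \<le> r j" "0 \<le> t"
  shows "gcp_prob k r t m \<le> 1"
proof -
  have "(\<Sum>m\<in>{m}. gcp_prob k r t m) \<le> (\<Sum>m. gcp_prob k r t m)"
    by (intro sum_le_suminf summable_gcp_prob) (auto intro: gcp_prob_nonneg assms)
  also have "\<dots> = 1"
    using sums_unique[OF gcp_prob_sums[of k r t 1]] by simp
  finally show ?thesis by simp
qed

section \<open>Identifying the law of a counting process from its generating function\<close>

lemma (in prob_space) sums_prob_eq: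
  assumes [measurable]: "X \<in> measurable M (count_space UNIV)" and A [measurable]: "{\<omega> \<in> space M. Q \<omega>} \<in> events"
  shows "(\<lambda>m::nat. prob {\<omega> \<in> space M. X \<omega> = m \<and> Q \<omega>}) sums prob {\<omega> \<in> space M. Q \<omega>}"
proof -
  have "(\<lambda>m. prob {\<omega> \<in> space M. X \<omega> = m \<and> Q \<omega>}) sums
      prob (\<Union>m. {\<omega> \<in> space M. X \<omega> = m \<and> Q \<omega>})"
    by (rule finite_measure_UNION) (auto simp: disjoint_family_on_def)
  also have "(\<Union>m. {\<omega> \<in> space M. X \<omega> = m \<and> Q \<omega>}) = {\<omega> \<in> space M. Q \<omega>}" by auto
  finally show ?thesis .
qed

text \<open>\<open>u ^ X\<close> is split over the values of \<open>X\<close>. Series and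
  expectation may be exchanged because the integrated norms are bounded by the probabilities of
  these values, which are summable.\<close>

lemma (in prob_space) pgf_sums:
  assumes [measurable]: "X \<in> measurable M (count_space UNIV)" and u: "\<bar>u\<bar> \<le> 1"
  shows "(\<lambda>m. prob {\<omega> \<in> space M. X \<omega> = m} * u ^ m) sums expectation (\<lambda>\<omega>. u ^ X \<omega> :: real)"
proof -
  define f where "f m \<omega> = u ^ m * indicator {\<omega> \<in> space M. X \<omega> = m} \<omega>" for m \<omega>
  have int: "integrable M (f m)" for m
    unfolding f_def by (intro integrable_mult_right integrable_real_indicator) (auto simp: emeasure_eq_measure)
  have single: "(\<lambda>m. f m \<omega>) sums u ^ X \<omega>" if "\<omega> \<in> space M" for \<omega>
  proof -
    have "(\<lambda>m. f m \<omega>) = (\<lambda>m. if m = X \<omega> then u ^ m else 0)"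
      using that by (auto simp: f_def)
    then show ?thesis by (simp only: sums_single)
  qed
  have "(\<lambda>m. integral\<^sup>L M (f m)) sums (\<integral>\<omega>. (\<Sum>m. f m \<omega>) \<partial>M)"
  proof (rule sums_integral[OF int])
    have "summable (\<lambda>m. norm (f m \<omega>))" if "\<omega> \<in> space M" for \<omega>
      by (rule summable_finite[of "{X \<omega>}"]) (auto simp: f_def)
    then show "AE \<omega> in M. summable (\<lambda>m. norm (f m \<omega>))" by simp
    have p: "summable (\<lambda>m. prob {\<omega> \<in> space M. X \<omega> = m})"
      using sums_summable[OF sums_prob_eq[of X "\<lambda>_. True"]] by simp
    have "(\<integral>\<omega>. norm (f m \<omega>) \<partial>M) = \<bar>u\<bar> ^ m * prob {\<omega> \<in> space M. X \<omega> = m}" for m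
      by (simp add: f_def abs_mult power_abs)
    moreover have "\<bar>u\<bar> ^ m * prob {\<omega> \<in> space M. X \<omega> = m} \<le> prob {\<omega> \<in> space M. X \<omega> = m}" for m
      using u by (intro mult_left_le_one_le) (auto intro: power_le_one)
    ultimately show "summable (\<lambda>m. \<integral>\<omega>. norm (f m \<omega>) \<partial>M)"
      by (intro summable_comparison_test'[OF p]) auto
  qed
  also have "(\<integral>\<omega>. (\<Sum>m. f m \<omega>) \<partial>M) = expectation (\<lambda>\<omega>. u ^ X \<omega>)"
    by (intro Bochner_Integration.integral_cong) (auto simp: sums_unique[OF single])
  finally show ?thesis by (simp add: f_def mult.commute)
qed

text \<open>Both sides have the same generating function for \<open>\<bar>u\<bar> < 1\<close>, so
  their coefficients agree.\<close>

lemma prob_generalized_counting_process: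
  assumes "prob_space P" "generalized_counting_process P k r M" "0 \<le> t"
  shows "measure P {\<omega> \<in> space P. M t \<omega> = m} = gcp_prob k r t m"
proof -
  interpret prob_space P by fact
  have "(\<lambda>m. prob {\<omega> \<in> space P. M t \<omega> = m}) = gcp_prob k r t"
  proof (rule powser_coeff_unique[of 1])
    fix u :: real assume u: "\<bar>u\<bar> < 1"
    show "(\<lambda>n. gcp_prob k r t n * u ^ n) sums exp (- t * (\<Sum>j=1..k. r j * (1 - u ^ j)))"
      by (rule gcp_prob_sums)
    have M: "M t \<in> measurable P (count_space UNIV)"
      and pgf: "expectation (\<lambda>\<omega>. u ^ M t \<omega>) = exp (- t * (\<Sum>j=1..k. r j * (1 - u ^ j)))"
      using assms(2,3) u unfolding generalized_counting_process_def by auto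
    show "(\<lambda>n. prob {\<omega> \<in> space P. M t \<omega> = n} * u ^ n) sums exp (- t * (\<Sum>j=1..k. r j * (1 - u ^ j)))"
      using pgf_sums[OF M, of u] u pgf by simp
  qed simp
  then show ?thesis by metis
qed

section \<open>The forward equation tested against a bounded sequence\<close>

lemma sums_shift_right:
  fixes a :: "nat \<Rightarrow> 'a::real_normed_vector"
  shows "(\<lambda>n. if j \<le> n then a (n - j) else 0) sums S \<longleftrightarrow> a sums S"
  using sums_zero_iff_shift[of j "\<lambda>n. if j \<le> n then a (n - j) else 0" S] by simp

text \<open>With the factor \<open>exp (- t * R)\<close> taken out, \<open>R\<close> being the total
  rate, the remaining series in \<open>gcp_coeff\<close> has nonnegative coefficients increasing in
  time and can be differentiated termwise. The product rule with the exponential then contributes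
  the negative term.\<close>

lemma gcp_prob_mixture_has_derivative:
  assumes r: "\<And>j. j \<in> {1..k} \<Longrightarrow> 0 \<le> r j" and b: "\<And>n. \<bar>b n\<bar> \<le> 1" and t: "0 \<le> t"
  shows "((\<lambda>t. \<Sum>n. gcp_prob k r t n * b n) has_real_derivative
      (\<Sum>j=1..k. r j * (\<Sum>n. gcp_prob k r t n * b (n + j)))
        - (\<Sum>j=1..k. r j) * (\<Sum>n. gcp_prob k r t n * b n)) (at t within {0..})"
proof -
  \<comment> \<open>Any bound beyond \<open>t\<close> works: domination needs a bounded interval,
    and near \<open>t\<close> the sets \<open>{0..T}\<close> and \<open>{0..}\<close>
    coincide.\<close>
  define T where "T = t + 1"
  define c where "c = gcp_coeff k r"
  define c' where "c' x n = (\<Sum>j=1..k. r j * (if j \<le> n then c x (n - j) else 0))" for x n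
  define D where "D = (\<Sum>j=1..k. r j * (\<Sum>n. c t n * b (n + j)))"
  have summable_b: "summable (\<lambda>n. c x n * b (n + j))" if "0 \<le> x" for x j
  proof (rule summable_comparison_test'[of "c x"])
    show "summable (c x)" unfolding c_def by (rule summable_gcp_coeff)
    show "norm (c x n * b (n + j)) \<le> c x n" for n
      using gcp_coeff_nonneg[of x k r n] r that mult_left_le[OF b[of "n + j"], of "c x n"]
      by (simp add: c_def abs_mult)
  qed
  \<comment> \<open>Reindexing moves the shift from the coefficient to the test sequence: the sum of
    \<open>c t (n - j) * b n\<close> over \<open>n \<ge> j\<close> is the sum of
    \<open>c t n * b (n + j)\<close>.\<close>
  have c'_sums: "(\<lambda>n. c' t n * b n) sums D"
  proof -
    have "(\<lambda>n. (if j \<le> n then c t (n - j) else 0) * b n) sums (\<Sum>n. c t n * b (n + j))" for j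
    proof -
      have "(\<lambda>n. if j \<le> n then c t (n - j) * b (n - j + j) else 0) sums (\<Sum>n. c t n * b (n + j))"
        using sums_shift_right[of j "\<lambda>n. c t n * b (n + j)"] summable_sums[OF summable_b[OF t, of j]]
        by simp
      then show ?thesis by (rule sums_cong[THEN iffD1, rotated]) simp
    qed
    then have "(\<lambda>n. \<Sum>j=1..k. r j * ((if j \<le> n then c t (n - j) else 0) * b n)) sums D"
      unfolding D_def by (intro sums_sum sums_mult)
    then show ?thesis by (simp add: c'_def sum_distrib_right mult.assoc)
  qed
  have "\<exists>g. \<forall>x\<in>{0..T}. (\<lambda>n. c x n * b n) sums g x \<and>
      (g has_real_derivative (\<Sum>n. c' x n * b n)) (at x within {0..T})"
  proof (rule has_field_derivative_series)
    show "((\<lambda>x. c x n * b n) has_real_derivative c' x n * b n) (at x within {0..T})" for n x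
      unfolding c_def c'_def
      by (intro DERIV_cmult_right has_field_derivative_at_within[OF gcp_coeff_has_derivative])
    \<comment> \<open>The majorant is \<open>c' T n\<close>: \<open>c'\<close> is nonnegative and
      increasing in time, and \<open>b\<close> is bounded by 1.\<close>
    show "uniform_limit {0..T} (\<lambda>n x. \<Sum>i<n. c' x i * b i) (\<lambda>x. \<Sum>n. c' x n * b n) sequentially"
    proof (rule Weierstrass_m_test)
      fix n x assume x: "x \<in> {0..T}"
      have "0 \<le> c' x n" and "c' x n \<le> c' T n"
        using x r gcp_coeff_nonneg[of x k r] gcp_coeff_mono[of x T k r] unfolding c'_def c_def
        by (auto intro!: sum_nonneg sum_mono mult_left_mono)
      then show "norm (c' x n * b n) \<le> c' T n"
        using mult_left_le[OF b[of n], of "c' x n"] by (simp add: abs_mult)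
    next
      have "summable (\<lambda>n. if j \<le> n then c T (n - j) else 0)" for j
        using summable_gcp_coeff[of k r T] sums_shift_right[of j "c T"]
        unfolding summable_def c_def by blast
      then show "summable (c' T)"
        unfolding c'_def by (intro summable_sum summable_mult)
    qed
    show "summable (\<lambda>n. c t n * b n)" using summable_b[OF t, of 0] by simp
    show "t \<in> {0..T}" using t by (simp add: T_def)
  qed simp
  then obtain g where g: "\<And>x. x \<in> {0..T} \<Longrightarrow> (\<lambda>n. c x n * b n) sums g x"
      and "\<forall>x\<in>{0..T}. (g has_real_derivative (\<Sum>n. c' x n * b n)) (at x within {0..T})"
    by blast
  then have g': "(g has_real_derivative D) (at t within {0..T})"
    using t unfolding sums_unique[OF c'_sums] by (simp add: T_def)
  have "at t within {0..T} = at t within {0..}"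
    by (rule at_within_nhd[of _ "{..<T}"]) (auto simp: T_def)
  moreover have "((\<lambda>x. \<Sum>n. c x n * b n) has_real_derivative D) (at t within {0..T})"
    by (rule has_field_derivative_transform_within[OF g' zero_less_one])
      (use t in \<open>auto simp: T_def intro!: sums_unique g\<close>)
  ultimately have der: "((\<lambda>x. \<Sum>n. c x n * b n) has_real_derivative D) (at t within {0..})"
    by simp
  define R where "R = (\<Sum>j=1..k. r j)"
  have eq: "(\<Sum>n. gcp_prob k r x n * b (n + j)) = exp (- x * R) * (\<Sum>n. c x n * b (n + j))"
    if "0 \<le> x" for x j
    unfolding gcp_prob_def R_def c_def mult.assoc
    by (rule suminf_mult) (use summable_b[OF that, of j] in \<open>simp add: c_def\<close>)
  have "((\<lambda>x. exp (- x * R) * (\<Sum>n. c x n * b n)) has_real_derivative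
      exp (- t * R) * D - R * (exp (- t * R) * (\<Sum>n. c t n * b n))) (at t within {0..})"
    by (auto intro!: derivative_eq_intros der)
  also have "exp (- t * R) * D = (\<Sum>j=1..k. r j * (\<Sum>n. gcp_prob k r t n * b (n + j)))"
    unfolding eq[OF t] D_def sum_distrib_left by (simp add: mult.left_commute)
  also have "exp (- t * R) * (\<Sum>n. c t n * b n) = (\<Sum>n. gcp_prob k r t n * b n)"
    using eq[OF t, of 0] by simp
  finally show ?thesis
    unfolding R_def[symmetric]
    by (rule has_field_derivative_transform_within[OF _ zero_less_one]) (use t eq[of _ 0] in auto)
qed

section \<open>Conditioning on the random time\<close>

text \<open>On the event \<open>M0 t = s\<close> the random time is the constant
  \<open>real s\<close>. Independence of \<open>M0\<close> from the family splits off the mass of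
  \<open>M0\<close>, and independence within the family gives the product.\<close>

lemma igcp_pmf_sums:
  fixes M :: "'q::finite \<Rightarrow> real \<Rightarrow> 'a \<Rightarrow> nat"
  assumes P: "prob_space P"
    and M: "\<And>i. generalized_counting_process P (k i) (lam i) (M i)" "independent_processes P M"
    and M0: "generalized_counting_process P k0 mu M0" "independent_of_family P M0 M"
    and t: "0 \<le> t" and n: "\<And>i. n $ i = int (n' i)"
  shows "(\<lambda>s. gcp_prob k0 mu t s * (\<Prod>i\<in>UNIV. gcp_prob (k i) (lam i) (real s) (n' i)))
    sums igcp_pmf P M M0 n t"
proof -
  interpret prob_space P by fact
  have meas [measurable]: "M i x \<in> measurable P (count_space UNIV)"
      "M0 x \<in> measurable P (count_space UNIV)" if "0 \<le> x" for i x
    using M(1) M0(1) that by (auto simp: generalized_counting_process_def)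
  have M_meas [measurable]: "M i (real s) \<in> measurable P (count_space UNIV)" for i s
    by (rule meas) simp
  note [measurable] = meas(2)[OF t]
  have path: "path X \<omega> \<in> space path_space" for X :: "real \<Rightarrow> 'a \<Rightarrow> nat" and \<omega>
    by (auto simp: path_def path_space_def space_PiM)
  \<comment> \<open>Independence is stated for whole paths, so conditions at a single time must be
    seen as measurable sets of paths.\<close>
  have ev: "{f \<in> space path_space. f x = m} \<in> sets path_space" if "0 \<le> x" for x m
  proof -
    have "(\<lambda>f. f x) -` {m} \<inter> space path_space \<in> sets path_space"
      unfolding path_space_def using that
      by (intro measurable_sets[OF measurable_component_singleton]) auto
    also have "(\<lambda>f. f x) -` {m} \<inter> space path_space = {f \<in> space path_space. f x = m}" by auto
    finally show ?thesis .
  qed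
  have prod: "prob {\<omega> \<in> space P. \<forall>i. M i (real s) \<omega> = n' i}
      = (\<Prod>i\<in>UNIV. gcp_prob (k i) (lam i) (real s) (n' i))" for s
  proof -
    define A where "A i = {f \<in> space path_space. f (real s) = n' i}" for i
    have vim: "path (M i) -` A i \<inter> space P = {\<omega> \<in> space P. M i (real s) \<omega> = n' i}" for i
      using path[of "M i"] by (auto simp: A_def path_def)
    have "{\<omega> \<in> space P. \<forall>i. M i (real s) \<omega> = n' i} = (\<Inter>i\<in>UNIV. path (M i) -` A i \<inter> space P)"
      unfolding vim by auto
    also have "prob \<dots> = (\<Prod>i\<in>UNIV. prob (path (M i) -` A i \<inter> space P))"
      by (rule indep_varsD_finite[OF M(2)[unfolded independent_processes_def]])
        (auto simp: A_def intro: ev)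
    also have "\<dots> = (\<Prod>i\<in>UNIV. gcp_prob (k i) (lam i) (real s) (n' i))"
      by (simp add: vim prob_generalized_counting_process[OF P M(1)])
    finally show ?thesis .
  qed
  have indep: "prob {\<omega> \<in> space P. M0 t \<omega> = s \<and> (\<forall>i. M i (real s) \<omega> = n' i)}
      = gcp_prob k0 mu t s * (\<Prod>i\<in>UNIV. gcp_prob (k i) (lam i) (real s) (n' i))" for s
  proof -
    define A where "A = {f \<in> space path_space. f t = s}"
    have A: "A \<in> sets path_space" unfolding A_def using t by (rule ev)
    \<comment> \<open>\<open>B\<close> is a set of families of paths, as independence of
      \<open>M0\<close> from all coordinates jointly demands; it is a finite intersection over the
      coordinates.\<close>
    define B where "B = {F \<in> space (PiM UNIV (\<lambda>_. path_space)). \<forall>i. F i (real s) = n' i}"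
    have "B = (\<Inter>i. {F \<in> space (PiM UNIV (\<lambda>_. path_space)). F i (real s) = n' i})"
      by (auto simp: B_def)
    moreover have "{F \<in> space (PiM UNIV (\<lambda>_. path_space)). F i (real s) = n' i}
        \<in> sets (PiM UNIV (\<lambda>_::'q. path_space))" for i
    proof -
      have "(\<lambda>F. F i) -` {f \<in> space path_space. f (real s) = n' i} \<inter> space (PiM UNIV (\<lambda>_. path_space))
          \<in> sets (PiM UNIV (\<lambda>_::'q. path_space))"
        by (rule measurable_sets[OF measurable_component_singleton[of i UNIV "\<lambda>_. path_space"] ev]) auto
      also have "(\<lambda>F. F i) -` {f \<in> space path_space. f (real s) = n' i} \<inter> space (PiM UNIV (\<lambda>_. path_space))
          = {F \<in> space (PiM UNIV (\<lambda>_. path_space)). F i (real s) = n' i}"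
        by (auto simp: space_PiM)
      finally show ?thesis .
    qed
    ultimately have B: "B \<in> sets (PiM UNIV (\<lambda>_. path_space))"
      by (simp add: sets.finite_INT)
    have vimA: "path M0 -` A \<inter> space P = {\<omega> \<in> space P. M0 t \<omega> = s}"
      using path[of M0] t by (auto simp: A_def path_def)
    have "path (M i) \<omega> (real s) = M i (real s) \<omega>" for i \<omega>
      by (simp add: path_def)
    then have vimB: "(\<lambda>\<omega> i. path (M i) \<omega>) -` B \<inter> space P
        = {\<omega> \<in> space P. \<forall>i. M i (real s) \<omega> = n' i}"
      using path by (auto simp: B_def space_PiM)
    have "prob ((path M0 -` A \<inter> space P) \<inter> ((\<lambda>\<omega> i. path (M i) \<omega>) -` B \<inter> space P))
        = prob (path M0 -` A \<inter> space P) * prob ((\<lambda>\<omega> i. path (M i) \<omega>) -` B \<inter> space P)"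
      by (rule indep_setD[OF M0(2)[unfolded independent_of_family_def]])
        (rule in_vimage_algebra, fact)+
    also have "(path M0 -` A \<inter> space P) \<inter> ((\<lambda>\<omega> i. path (M i) \<omega>) -` B \<inter> space P)
        = {\<omega> \<in> space P. M0 t \<omega> = s \<and> (\<forall>i. M i (real s) \<omega> = n' i)}"
      unfolding vimA vimB by auto
    finally show ?thesis
      unfolding vimA vimB prod by (simp add: prob_generalized_counting_process[OF P M0(1) t])
  qed
  have igcp: "igcp M M0 t \<omega> = n \<longleftrightarrow> (\<forall>i. M i (real (M0 t \<omega>)) \<omega> = n' i)" for \<omega>
    by (simp add: igcp_def vec_eq_iff n)
  have "(\<lambda>s. prob {\<omega> \<in> space P. M0 t \<omega> = s \<and> igcp M M0 t \<omega> = n}) sums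
      prob {\<omega> \<in> space P. igcp M M0 t \<omega> = n}"
  proof (rule sums_prob_eq)
    \<comment> \<open>Measurability at a random time: splitting by the value of \<open>M0 t\<close>
      leaves a countable union of events at fixed times.\<close>
    have "{\<omega> \<in> space P. igcp M M0 t \<omega> = n}
        = (\<Union>s. {\<omega> \<in> space P. M0 t \<omega> = s \<and> (\<forall>i. M i (real s) \<omega> = n' i)})"
      unfolding igcp by auto
    also have "\<dots> \<in> events" by measurable
    finally show "{\<omega> \<in> space P. igcp M M0 t \<omega> = n} \<in> events" .
  qed measurable
  moreover have "{\<omega> \<in> space P. M0 t \<omega> = s \<and> igcp M M0 t \<omega> = n}
      = {\<omega> \<in> space P. M0 t \<omega> = s \<and> (\<forall>i. M i (real s) \<omega> = n' i)}" for s
    unfolding igcp by auto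
  ultimately show ?thesis by (simp add: indep igcp_pmf_def)
qed

section \<open>Integer vectors and convolution over boxes\<close>

text \<open>This confines the sum over all \<open>m\<close> to the finite box
  \<open>0 \<le> m \<le> n\<close>.\<close>

lemma igcp_pmf_neg: "\<not> 0 \<le> n \<Longrightarrow> igcp_pmf P M M0 n t = 0"
proof -
  assume n: "\<not> 0 \<le> n"
  have "0 \<le> igcp M M0 t \<omega>" for \<omega> by (simp add: igcp_def less_eq_vec_def)
  with n have "{\<omega> \<in> space P. igcp M M0 t \<omega> = n} = {}" by auto
  then show ?thesis by (simp only: igcp_pmf_def measure_empty)
qed

lemma bij_betw_int_vec_box:
  "bij_betw (\<lambda>x. \<chi> i. int (x i)) (PiE UNIV (\<lambda>i. {..nat (n $ i)})) {m::int ^ 'q. 0 \<le> m \<and> m \<le> n}"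
  if "0 \<le> n"
  by (rule bij_betw_byWitness[where f' = "\<lambda>m i. nat (m $ i)"])
    (use that in \<open>auto simp: less_eq_vec_def vec_eq_iff PiE_iff nat_le_iff le_nat_iff nat_mono\<close>)

lemma finite_int_vec_box: "finite {m::int ^ 'q::finite. 0 \<le> m \<and> m \<le> n}"
proof (cases "0 \<le> n")
  case True
  have "finite (PiE (UNIV :: 'q set) (\<lambda>i. {..nat (n $ i)}))" by (intro finite_PiE) auto
  then show ?thesis using bij_betw_finite[OF bij_betw_int_vec_box[OF True]] by simp
next
  case False
  then have "{m. 0 \<le> m \<and> m \<le> n} = {}" using order_trans by blast
  then show ?thesis by (simp only: finite.emptyI)
qed

text \<open>Each coordinate satisfies the convolution identity \<open>gcp_prob_add\<close>.
  Multiplying out the product of sums gives one term per choice of a summand in every coordinate,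
  and such choices are the vectors in the box.\<close>

lemma prod_gcp_prob_convolution:
  fixes n :: "int ^ 'q::finite"
  assumes n: "0 \<le> n" and "0 \<le> s" "0 \<le> t" and lam: "\<And>i j. j \<in> {1..k i} \<Longrightarrow> 0 \<le> lam i j"
  shows "(\<Sum>m | 0 \<le> m \<and> m \<le> n. (\<Prod>i\<in>UNIV. gcp_prob (k i) (lam i) s (nat (m $ i)))
        * (\<Prod>i\<in>UNIV. gcp_prob (k i) (lam i) t (nat ((n - m) $ i))))
    = (\<Prod>i\<in>UNIV. gcp_prob (k i) (lam i) (s + t) (nat (n $ i)))"
proof -
  have "(\<Prod>i\<in>UNIV. gcp_prob (k i) (lam i) (s + t) (nat (n $ i)))
      = (\<Prod>i\<in>UNIV. \<Sum>l\<le>nat (n $ i). gcp_prob (k i) (lam i) s l * gcp_prob (k i) (lam i) t (nat (n $ i) - l))"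
    by (intro prod.cong refl gcp_prob_add lam assms)
  also have "\<dots> = (\<Sum>x\<in>PiE UNIV (\<lambda>i. {..nat (n $ i)}).
      \<Prod>i\<in>UNIV. gcp_prob (k i) (lam i) s (x i) * gcp_prob (k i) (lam i) t (nat (n $ i) - x i))"
    by (rule prod_sum_PiE) auto
  finally have "(\<Prod>i\<in>UNIV. gcp_prob (k i) (lam i) (s + t) (nat (n $ i)))
      = (\<Sum>x\<in>PiE UNIV (\<lambda>i. {..nat (n $ i)}).
      \<Prod>i\<in>UNIV. gcp_prob (k i) (lam i) s (x i) * gcp_prob (k i) (lam i) t (nat (n $ i) - x i))" .
  \<comment> \<open>Truncated subtraction matches the integer difference even when that is negative,
    as both sides are then 0.\<close>
  moreover have "nat (a - int l) = nat a - l" for a l by arith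
  ultimately show ?thesis
    unfolding sum.reindex_bij_betw[OF bij_betw_int_vec_box[OF n], symmetric]
    by (simp add: prod.distrib)
qed

section \<open>The differential equation of the multivariate IGCP\<close>

theorem proposition4p3:
  fixes P :: "'a measure"
    and M :: "'q::finite \<Rightarrow> real \<Rightarrow> 'a \<Rightarrow> nat" and M0 :: "real \<Rightarrow> 'a \<Rightarrow> nat"
    and k :: "'q \<Rightarrow> nat" and k0 :: nat
    and lam :: "'q \<Rightarrow> nat \<Rightarrow> real" and mu :: "nat \<Rightarrow> real"
    and Lam :: real
  assumes "prob_space P"
    and "\<And>i. generalized_counting_process P (k i) (lam i) (M i)"
    and "independent_processes P M"
    and "generalized_counting_process P k0 mu M0"
    and "independent_of_family P M0 M"
    and "Lam = (\<Sum>i\<in>UNIV. \<Sum>j=1..k i. lam i j)"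
  shows "\<forall>n::int ^ 'q. 0 \<le> n \<longrightarrow>
    (\<forall>t\<ge>0. ((\<lambda>s. igcp_pmf P M M0 n s) has_real_derivative
        - (\<Sum>j0=1..k0. mu j0 * (1 - exp (- real j0 * Lam))) * igcp_pmf P M M0 n t
        + (\<Sum>\<^sub>\<infinity>m\<in>{m. 0 \<le> m \<and> m \<noteq> 0}. igcp_pmf P M M0 (n - m) t *
            (\<Sum>j0=1..k0. mu j0 * exp (- real j0 * Lam) *
              (\<Sum>x\<in>(\<Pi> i\<in>UNIV. Omega (k i) (m $ i)).
                \<Prod>i\<in>UNIV. \<Prod>j=1..k i. (real j0 * lam i j) ^ x i j / fact (x i j)))))
        (at t within {0..})) \<and>
    igcp_pmf P M M0 n 0 = (if n = 0 then 1 else 0)"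
proof (intro allI impI conjI)
  fix n :: "int ^ 'q" assume n: "0 \<le> n"
  let ?W = "\<lambda>m::int ^ 'q. (\<Sum>j0=1..k0. mu j0 * exp (- real j0 * Lam) *
          (\<Sum>x\<in>(\<Pi> i\<in>UNIV. Omega (k i) (m $ i)).
            \<Prod>i\<in>UNIV. \<Prod>j=1..k i. (real j0 * lam i j) ^ x i j / fact (x i j)))"
  \<comment> \<open>For \<open>0 \<le> m\<close> this is the joint mass of the independent
    \<open>M i\<close> at time \<open>s\<close>. Negative entries would be read as 0, so identities
    involving \<open>g\<close> as a mass are only claimed for nonnegative vectors.\<close>
  define g where "g m s = (\<Prod>i\<in>UNIV. gcp_prob (k i) (lam i) s (nat (m $ i)))"
    for m :: "int ^ 'q" and s
  define a where "a = gcp_prob k0 mu"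
  define p where "p = igcp_pmf P M M0"
  have lam: "0 \<le> lam i j" if "j \<in> {1..k i}" for i j
    using assms(2)[of i] that unfolding generalized_counting_process_def by (simp only: less_imp_le)
  have mu: "0 \<le> mu j" if "j \<in> {1..k0}" for j
    using assms(4) that unfolding generalized_counting_process_def by (simp only: less_imp_le)
  have p_sums: "(\<lambda>s. a t s * g m (real s)) sums p m t" if "0 \<le> t" "0 \<le> m" for m t
    unfolding a_def g_def p_def using that
    by (intro igcp_pmf_sums[OF assms(1-5)]) (simp_all add: less_eq_vec_def)
  have g_bound: "\<bar>g m s\<bar> \<le> 1" if "0 \<le> s" for m s
  proof -
    have "0 \<le> gcp_prob (k i) (lam i) s l" "gcp_prob (k i) (lam i) s l \<le> 1" for i l
      by (intro gcp_prob_nonneg gcp_prob_le_1 that lam; assumption)+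
    then show ?thesis unfolding g_def abs_prod by (intro prod_le_1) simp
  qed
  show "igcp_pmf P M M0 n 0 = (if n = 0 then 1 else 0)"
  proof -
    \<comment> \<open>At time 0 all mass of \<open>M0\<close> sits at 0, and so does that of every
      \<open>M i\<close>.\<close>
    have "(\<lambda>s. a 0 s * g n (real s)) = (\<lambda>s. if s = 0 then g n (real s) else 0)"
      by (auto simp: a_def gcp_prob_0)
    then have "p n 0 = g n 0"
      using sums_unique2[OF p_sums[OF order_refl n]] sums_single[of 0 "\<lambda>s. g n (real s)"] by simp
    also have "\<dots> = (if n = 0 then 1 else 0)"
    proof (cases "n = 0")
      case False
      then obtain i where "n $ i \<noteq> 0" by (auto simp: vec_eq_iff)
      moreover have "0 \<le> n $ i" using n by (simp add: less_eq_vec_def)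
      ultimately have "nat (n $ i) \<noteq> 0" by simp
      then have "g n 0 = 0" unfolding g_def by (auto simp: gcp_prob_0)
      with False show ?thesis by simp
    qed (simp add: g_def gcp_prob_0)
    finally show ?thesis by (simp add: p_def)
  qed
  fix t :: real assume t: "0 \<le> t"
  have exp_Lam: "(\<Prod>i\<in>UNIV. exp (- s * (\<Sum>j=1..k i. lam i j))) = exp (- s * Lam)" for s
    unfolding assms(6) sum_distrib_left[of _ _ UNIV] by (simp only: exp_sum[OF finite])
  then have g_zero: "g 0 s = exp (- s * Lam)" for s
    unfolding g_def by (simp only: zero_index nat_zero_as_int[symmetric] nat_0 gcp_prob_zero)
  \<comment> \<open>The sum over tuples of exponents factors into one sum per coordinate, and
    \<open>exp (- real j0 * Lam)\<close> into the matching normalizing factors.\<close>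
  have g_Omega: "exp (- real j0 * Lam) * (\<Sum>x\<in>(\<Pi> i\<in>UNIV. Omega (k i) (m $ i)).
      \<Prod>i\<in>UNIV. \<Prod>j=1..k i. (real j0 * lam i j) ^ x i j / fact (x i j)) = g m (real j0)"
    if m: "0 \<le> m" for m j0
  proof -
    have "(\<Sum>x\<in>(\<Pi> i\<in>UNIV. Omega (k i) (m $ i)).
        \<Prod>i\<in>UNIV. \<Prod>j=1..k i. (real j0 * lam i j) ^ x i j / fact (x i j))
      = (\<Prod>i\<in>UNIV. gcp_coeff (k i) (lam i) (real j0) (nat (m $ i)))"
    proof -
      have "int (nat (m $ i)) = m $ i" for i using m by (simp add: less_eq_vec_def)
      then show ?thesis
        unfolding gcp_coeff_def by (subst prod_sum_PiE) (simp_all add: PiE_def)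
    qed
    then show ?thesis
      unfolding g_def gcp_prob_def prod.distrib exp_Lam by (simp only:)
  qed
  \<comment> \<open>Exchange the finite sum over \<open>m\<close> with the series over
    \<open>s\<close>; for fixed \<open>s\<close> the inner sum is the convolution of the laws at
    times \<open>j\<close> and \<open>s\<close>.\<close>
  have conv: "(\<Sum>m | 0 \<le> m \<and> m \<le> n. p (n - m) t * g m (real j)) = (\<Sum>s. a t s * g n (real (s + j)))" for j
  proof -
    have "(\<lambda>s. \<Sum>m | 0 \<le> m \<and> m \<le> n. a t s * g (n - m) (real s) * g m (real j)) sums
        (\<Sum>m | 0 \<le> m \<and> m \<le> n. p (n - m) t * g m (real j))"
      by (intro sums_sum sums_mult2 p_sums t) (simp add: less_eq_vec_def)
    also have "(\<lambda>s. \<Sum>m | 0 \<le> m \<and> m \<le> n. a t s * g (n - m) (real s) * g m (real j))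
        = (\<lambda>s. a t s * g n (real (s + j)))"
    proof
      fix s
      have "(\<Sum>m | 0 \<le> m \<and> m \<le> n. g m (real j) * g (n - m) (real s)) = g n (real j + real s)"
        unfolding g_def by (rule prod_gcp_prob_convolution) (use n lam in auto)
      then have "a t s * g n (real (s + j)) = a t s * (\<Sum>m | 0 \<le> m \<and> m \<le> n. g m (real j) * g (n - m) (real s))"
        by (simp add: add.commute)
      then show "(\<Sum>m | 0 \<le> m \<and> m \<le> n. a t s * g (n - m) (real s) * g m (real j)) = a t s * g n (real (s + j))"
        by (simp only: sum_distrib_left mult_ac)
    qed
    finally show ?thesis by (rule sums_unique)
  qed
  define rhs where "rhs = (\<Sum>j=1..k0. mu j * (\<Sum>s. a t s * g n (real (s + j))))
        - (\<Sum>j=1..k0. mu j) * (\<Sum>s. a t s * g n (real s))"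
  \<comment> \<open>The bounded test sequence is \<open>g n (real s)\<close>, indexed by
    \<open>s\<close>.\<close>
  have der: "((\<lambda>t. \<Sum>s. a t s * g n (real s)) has_real_derivative rhs) (at t within {0..})"
    unfolding rhs_def a_def by (intro gcp_prob_mixture_has_derivative mu g_bound t) auto
  have "((\<lambda>s. p n s) has_real_derivative rhs) (at t within {0..})"
    by (rule has_field_derivative_transform_within[OF der zero_less_one])
      (use t sums_unique[OF p_sums[OF _ n], symmetric] in auto)
  moreover have "rhs = - (\<Sum>j0=1..k0. mu j0 * (1 - exp (- real j0 * Lam))) * p n t
        + (\<Sum>\<^sub>\<infinity>m\<in>{m. 0 \<le> m \<and> m \<noteq> 0}. p (n - m) t * ?W m)"
  proof -
    have "(\<Sum>\<^sub>\<infinity>m\<in>{m. 0 \<le> m \<and> m \<noteq> 0}. p (n - m) t * ?W m)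
       = (\<Sum>\<^sub>\<infinity>m\<in>{m. 0 \<le> m \<and> m \<le> n} - {0}. p (n - m) t * (\<Sum>j=1..k0. mu j * g m (real j)))"
    \<comment> \<open>Outside the box \<open>n - m\<close> has a negative entry and the term
      vanishes, so the infinite sum is in fact finite.\<close>
    proof (rule infsum_cong_neutral)
      fix m :: "int ^ 'q" assume "m \<in> {m. 0 \<le> m \<and> m \<noteq> 0} - ({m. 0 \<le> m \<and> m \<le> n} - {0})"
      then have "\<not> 0 \<le> n - m" by (auto simp: less_eq_vec_def)
      then have "p (n - m) t = 0" by (simp add: p_def igcp_pmf_neg)
      then show "p (n - m) t * ?W m = 0"
        by (simp only: mult_zero_left)
    next
      fix m :: "int ^ 'q" assume "m \<in> {m. 0 \<le> m \<and> m \<noteq> 0} \<inter> ({m. 0 \<le> m \<and> m \<le> n} - {0})"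
      then have "0 \<le> m" by simp
      then show "p (n - m) t * ?W m
          = p (n - m) t * (\<Sum>j=1..k0. mu j * g m (real j))"
        by (simp only: mult.assoc g_Omega)
    qed blast
    also have "\<dots> = (\<Sum>m\<in>{m. 0 \<le> m \<and> m \<le> n} - {0}. p (n - m) t * (\<Sum>j=1..k0. mu j * g m (real j)))"
      by (simp add: finite_int_vec_box)
    \<comment> \<open>The term \<open>m = 0\<close> is put back to complete the convolution and
      subtracted again; its weight is \<open>g 0 (real j) = exp (- real j * Lam)\<close>.\<close>
    also have "\<dots> = (\<Sum>m | 0 \<le> m \<and> m \<le> n. p (n - m) t * (\<Sum>j=1..k0. mu j * g m (real j)))
        - p n t * (\<Sum>j=1..k0. mu j * exp (- real j * Lam))"
      using n by (simp add: sum_diff1[OF finite_int_vec_box] g_zero)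
    also have "(\<Sum>m | 0 \<le> m \<and> m \<le> n. p (n - m) t * (\<Sum>j=1..k0. mu j * g m (real j)))
        = (\<Sum>j=1..k0. mu j * (\<Sum>m | 0 \<le> m \<and> m \<le> n. p (n - m) t * g m (real j)))"
      unfolding sum_distrib_left by (subst sum.swap) (simp only: mult.left_commute)
    also have "\<dots> = rhs + (\<Sum>j=1..k0. mu j) * p n t"
      by (simp only: conv rhs_def sums_unique[OF p_sums[OF t n], symmetric])
    finally have gain: "(\<Sum>\<^sub>\<infinity>m\<in>{m. 0 \<le> m \<and> m \<noteq> 0}. p (n - m) t * ?W m)
       = rhs + (\<Sum>j=1..k0. mu j) * p n t - p n t * (\<Sum>j=1..k0. mu j * exp (- real j * Lam))" .
    have loss: "(\<Sum>j=1..k0. mu j * (1 - exp (- real j * Lam)))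
        = (\<Sum>j=1..k0. mu j) - (\<Sum>j=1..k0. mu j * exp (- real j * Lam))"
      by (simp only: right_diff_distrib sum_subtractf mult_1_right)
    show ?thesis unfolding gain loss by (simp add: algebra_simps)
  qed
  ultimately show "((\<lambda>s. igcp_pmf P M M0 n s) has_real_derivative
        - (\<Sum>j0=1..k0. mu j0 * (1 - exp (- real j0 * Lam))) * igcp_pmf P M M0 n t
        + (\<Sum>\<^sub>\<infinity>m\<in>{m. 0 \<le> m \<and> m \<noteq> 0}. igcp_pmf P M M0 (n - m) t *
            (\<Sum>j0=1..k0. mu j0 * exp (- real j0 * Lam) *
              (\<Sum>x\<in>(\<Pi> i\<in>UNIV. Omega (k i) (m $ i)).
                \<Prod>i\<in>UNIV. \<Prod>j=1..k i. (real j0 * lam i j) ^ x i j / fact (x i j)))))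
        (at t within {0..})"
    unfolding p_def by (simp only:)
qed

end
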